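(* Let $q$ be a power of $2$, let $\alpha$ be a primitive element of $\mathbb{F}_{q^2}$, and let $b,c,d\in\mathbb{F}_{q^2}$. Then the number $M$ of zeros of $f(x)=x^{q+1}+bx^q+cx+d$ in $\mathbb{F}_{q^2}$ is given by $$M=\begin{cases} 1, & b=c=0,\ d=0,\\ q+1, & b=c=0,\ d\in\mathbb{F}_q^*,\\ 0, & b=c=0,\ d\notin\mathbb{F}_q,\\ 1, & b^q=c\neq0,\ d\in\mathbb{F}_q,\ d=c^{q+1},\\ q+1, & b^q=c\neq0,\ d\in\mathbb{F}_q,\ d\neq c^{q+1},\\ 0, & b^q=c\neq0,\ d\notin\mathbb{F}_q,\\ 1-|N'|, & b^q\neq c,\ b^{q+1}=c^{q+1},\ b^qd+cd^q=0,\\ 2-|N'|, & b^q\neq c,\ b^{q+1}=c^{q+1},\ b^qd+cd^q\neq0,\\ 2-|N|, & b^{q+1}\neq c^{q+1}. \end{cases}$$ Here $$h(x)=(d+bc)^qx^2+\bigl(\operatorname{Tr}(d)+b^{q+1}+c^{q+1}\bigr)x+d+bc,$$ $$N=\{\,i : 1\le i\le q,\ h(\alpha^{i(q-1)})=0\,\},\qquad N'=\{\,i : 1\le i\le q,\ i\neq k,\ h(\alpha^{i(q-1)})=0\,\},$$ and, in the cases where $b^{q+1}=c^{q+1}$ and $b^q\neq c$, $k$ denotes an integer with $1\le k\le q$ satisfying $b^q\alpha^{kq}+c\alpha^k=0$.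
   Context: $\mathbb{F}_q\subset\mathbb{F}_{q^2}$ are the finite fields with $q$ and $q^2$ elements; a primitive element of $\mathbb{F}_{q^2}$ is a generator of the cyclic group $\mathbb{F}_{q^2}^*$. $\operatorname{Tr}:\mathbb{F}_{q^2}\to\mathbb{F}_q$ is $\operatorname{Tr}(x)=x^q+x$. Zeros are counted as distinct elements of $\mathbb{F}_{q^2}$; $i$ ranges over integers. *)

theory Defs
  imports Complex_Main "HOL-Library.Cardinality" "HOL-Computational_Algebra.Primes"
begin

(* inverse 0 = 0 in the library, so closure under inverse needs no side condition. *)
definition is_subfield :: "'a::field set \<Rightarrow> bool" where
  "is_subfield K \<longleftrightarrow> 0 \<in> K \<and> 1 \<in> K \<and>
     (\<forall>x\<in>K. \<forall>y\<in>K. x + y \<in> K \<and> x * y \<in> K) \<and>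
     (\<forall>x\<in>K. - x \<in> K \<and> inverse x \<in> K)"

(* Equality with UNIV - {0} also forces the element to be nonzero. *)
definition primitive_element :: "'a::field \<Rightarrow> bool" where
  "primitive_element \<alpha> \<longleftrightarrow> {\<alpha> powi n | n::int. True} = UNIV - {0}"

(* The trace from the field with q^2 elements to its subfield with q elements. *)
definition Tr :: "nat \<Rightarrow> 'a::field \<Rightarrow> 'a" where
  "Tr q x = x ^ q + x"

definition f_fun :: "nat \<Rightarrow> 'a::field \<Rightarrow> 'a \<Rightarrow> 'a \<Rightarrow> 'a \<Rightarrow> 'a" where
  "f_fun q b c d x = x ^ (q + 1) + b * x ^ q + c * x + d"

definition h_fun :: "nat \<Rightarrow> 'a::field \<Rightarrow> 'a \<Rightarrow> 'a \<Rightarrow> 'a \<Rightarrow> 'a" where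
  "h_fun q b c d x =
     (d + b * c) ^ q * x ^ 2 + (Tr q d + b ^ (q + 1) + c ^ (q + 1)) * x + d + b * c"

definition N_set :: "nat \<Rightarrow> 'a::field \<Rightarrow> 'a \<Rightarrow> 'a \<Rightarrow> 'a \<Rightarrow> int set" where
  "N_set q \<alpha> b c d =
     {i. 1 \<le> i \<and> i \<le> int q \<and> h_fun q b c d (\<alpha> powi (i * (int q - 1))) = 0}"

definition N'_set :: "nat \<Rightarrow> 'a::field \<Rightarrow> 'a \<Rightarrow> 'a \<Rightarrow> 'a \<Rightarrow> int \<Rightarrow> int set" where
  "N'_set q \<alpha> b c d k =
     {i. 1 \<le> i \<and> i \<le> int q \<and> i \<noteq> k \<and> h_fun q b c d (\<alpha> powi (i * (int q - 1))) = 0}"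

definition admissible_k :: "nat \<Rightarrow> 'a::field \<Rightarrow> 'a \<Rightarrow> 'a \<Rightarrow> int \<Rightarrow> bool" where
  "admissible_k q \<alpha> b c k \<longleftrightarrow>
     1 \<le> k \<and> k \<le> int q \<and> b ^ q * \<alpha> powi (k * int q) + c * \<alpha> powi k = 0"

end

theory Submission
  imports Defs "HOL-Computational_Algebra.Polynomial"
begin

text \<open>
  Write \<open>N(x) = x^(q+1)\<close> and \<open>e = b^q + c\<close>; in characteristic 2 signs can be ignored.

  If \<open>e = 0\<close>, then \<open>f(x) = N(x + b) + (d + N(b))\<close>, so the zeros of \<open>f\<close> form a fibre of the norm
  map to \<open>K\<close>: it has \<open>q + 1\<close> elements over a nonzero element of \<open>K\<close>, one over 0, and none
  outside \<open>K\<close> (lemma \<open>card_zeros_shifted_norm\<close>).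

  If \<open>e \<noteq> 0\<close>, put \<open>D = d + bc\<close> and \<open>A = Tr(d) + N(b) + N(c)\<close>, so that
  \<open>h(u) = D^q u^2 + A u + D\<close>, and consider the quadratic \<open>Q(s) = s^2 + A s + N(D)\<close> over \<open>K\<close>.
  Two different substitutions lead to \<open>Q\<close>:

  \<^item> \<open>s = e x + d + N(b)\<close> identifies the zeros \<open>x\<close> of \<open>f\<close> with the roots of \<open>Q\<close> lying in \<open>K\<close>
    (lemma \<open>card_zeros_eq_quadratic\<close>);
  \<^item> for \<open>D \<noteq> 0\<close>, \<open>s = D^q u\<close> identifies the roots \<open>u\<close> of \<open>h\<close> of norm 1 with the roots of \<open>Q\<close>
    whose norm is \<open>N(D)\<close> (lemma \<open>card_unit_roots_eq_quadratic\<close>).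

  Every quadratic over \<open>K\<close> splits in the quadratic extension. Suppose \<open>D \<noteq> 0\<close>. If \<open>Q\<close> has two
  distinct roots, then either both lie in \<open>K\<close>, and neither has norm \<open>N(D)\<close>, or they are conjugate
  outside \<open>K\<close>, and each has norm equal to their product \<open>N(D)\<close>; a double root lies in \<open>K\<close> and has
  norm \<open>N(D)\<close>. So the two counts add up to 2 (lemma \<open>quadratic_root_dichotomy\<close>). For \<open>D = 0\<close> the
  quadratic \<open>Q\<close> has the two roots 0 and \<open>A\<close> in \<open>K\<close>, and \<open>h\<close> has no root of norm 1.

  It remains to rewrite the second count. The elements \<open>\<alpha>^(i(q-1))\<close> with \<open>1 \<le> i \<le> q\<close> are exactly the
  elements of norm 1 other than 1, and \<open>h(1) = N(e) \<noteq> 0\<close>; hence \<open>M = 2 - |N|\<close> whenever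
  \<open>b^q \<noteq> c\<close>. If moreover \<open>N(b) = N(c)\<close>, then the index \<open>k\<close> is the one with
  \<open>\<alpha>^(k(q-1)) = c / b^q\<close>, and this element is a root of \<open>h\<close> if and only if
  \<open>b^q d + c d^q = 0\<close> (lemma \<open>h_fun_special_point\<close>). Leaving out \<open>k\<close> therefore removes an element
  of \<open>N\<close> in exactly that case.
\<close>

section \<open>Fibres, roots and primitive elements\<close>

text \<open>
  A map for which the general upper bound on the size of the fibres is attained on average attains
  it on every fibre. For the norm, the trace and \<open>z \<mapsto> z^2 + z\<close> the bound is the degree of a
  polynomial, and attaining it shows in particular that no fibre is empty.
\<close>
lemma card_fibre_eq:
  assumes "finite A" "finite B" "f ` A \<subseteq> B"
    and le: "\<And>y. y \<in> B \<Longrightarrow> card {x\<in>A. f x = y} \<le> n"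
    and card: "card A = n * card B"
    and "y \<in> B"
  shows "card {x\<in>A. f x = y} = n"
proof -
  have "(\<Sum>y\<in>B. card {x\<in>A. f x = y}) = card A"
    using assms(1-3) sum.group[of A B f "\<lambda>_. 1::nat"] by simp
  hence "(\<Sum>y\<in>B. card {x\<in>A. f x = y}) = (\<Sum>y\<in>B. n)"
    using card by simp
  thus ?thesis
    using sum_mono_inv[of "\<lambda>y. card {x\<in>A. f x = y}" B "\<lambda>_. n" y] assms by blast
qed

lemma card_roots_trinomial_le:
  fixes a r :: "'a::idom"
  assumes "n \<ge> 2"
  shows "card {x. x ^ n + r * x = a} \<le> n"
proof -
  let ?p = "monom 1 n + [:-a, r:]"
  have c: "coeff ?p n = 1"
    using assms by (auto simp: coeff_pCons split: nat.splits)
  hence nz: "?p \<noteq> 0" by (metis coeff_0 zero_neq_one)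
  have "degree ?p \<le> n"
    using assms by (intro degree_add_le degree_monom_le) auto
  moreover have "{x. x ^ n + r * x = a} = {x. poly ?p x = 0}"
    by (auto simp: poly_monom algebra_simps)
  ultimately show ?thesis
    using card_poly_roots_bound[OF nz] by simp
qed

lemma primitive_element_nonzero:
  assumes "primitive_element \<alpha>"
  shows "\<alpha> \<noteq> 0"
proof -
  have "0 \<notin> {\<alpha> powi n |n::int. True}"
    using assms by (simp add: primitive_element_def)
  thus ?thesis by (metis (mono_tags, lifting) mem_Collect_eq power_int_1_right)
qed

section \<open>The quadratic extension\<close>

text \<open>
  The field \<open>K\<close> with \<open>q\<close> elements lies in the ambient type, its quadratic extension. Conjugation
  over \<open>K\<close> is the map \<open>x \<mapsto> x^q\<close>.
\<close>
locale char2_quadratic_extension =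
  fixes q :: nat and K :: "'a::finite_field set"
  assumes q_power: "\<exists>m\<ge>1. q = 2 ^ m"
    and card_field: "CARD('a) = q ^ 2"
    and subfield: "is_subfield K"
    and card_K: "card K = q"
begin

lemma q_ge_2: "q \<ge> 2"
  using q_power self_le_power[of "2::nat"] by force

lemma zero_power_q [simp]: "(0::'a) ^ q = 0"
  using q_ge_2 by simp

lemma even_q: "even q"
  using q_power by auto

lemma power_q_q: "(x ^ q) ^ q = (x::'a)"
  using finite_field_power_card_eq_same[of x]
  by (simp add: card_field power2_eq_square power_mult)

lemma two_eq_0: "(2::'a) = 0"
proof -
  \<comment> \<open>Conjugating \<open>- 1\<close> twice returns \<open>- 1\<close>, but an even power of \<open>- 1\<close> is 1.\<close>
  have "(- 1 :: 'a) = (((- 1) ^ q) ^ q)" by (simp add: power_q_q)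
  also have "\<dots> = 1" using even_q by simp
  finally show ?thesis by (metis one_add_one add.right_inverse)
qed

lemma char_eq_2: "CHAR('a) = 2"
proof -
  have "CHAR('a) dvd 2" using two_eq_0 by (metis of_nat_eq_0_iff_char_dvd of_nat_numeral)
  thus ?thesis
    using CHAR_not_1'[where ?'a = 'a] by (metis One_nat_def prime_nat_iff two_is_prime_nat)
qed

lemma add_self [simp]: "(x::'a) + x = 0"
  using two_eq_0 by (metis mult_2 mult_zero_left)

lemma add_self_left [simp]: "(x::'a) + (x + y) = y"
  by (simp flip: add.assoc)

lemma minus_eq [simp]: "- (x::'a) = x"
  using add_self minus_unique by blast

lemma add_eq_0_iff_eq: "(x::'a) + y = 0 \<longleftrightarrow> x = y"
  by (metis minus_eq eq_neg_iff_add_eq_0)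

lemma frob_add: "((x::'a) + y) ^ q = x ^ q + y ^ q"
proof -
  obtain m where "q = 2 ^ m" using q_power by auto
  thus ?thesis
    using freshmans_dream'[where ?'a = 'a, of q m x y] char_eq_2 by simp
qed

text \<open>
  The elements of \<open>K\<close> satisfy \<open>x^q = x\<close> by Lagrange's theorem in the multiplicative group of \<open>K\<close>,
  and this equation has no more than \<open>q\<close> solutions.
\<close>
lemma mem_K_iff: "x \<in> K \<longleftrightarrow> x ^ q = x"
proof -
  have sub: "K \<subseteq> {x. x ^ q = x}"
  proof
    fix x assume x: "x \<in> K"
    show "x \<in> {x. x ^ q = x}"
    proof (cases "x = 0")
      case False
      have cl: "u * v \<in> K" "inverse u \<in> K" if "u \<in> K" "v \<in> K" for u v
        using that subfield by (auto simp: is_subfield_def)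
      have "(\<Prod>y\<in>K-{0}. x * y) = \<Prod>(K-{0})"
        by (rule prod.reindex_bij_witness[of _ "\<lambda>y. inverse x * y" "\<lambda>y. x * y"])
           (use False x cl in auto)
      hence "x ^ card (K - {0}) * \<Prod>(K-{0}) = \<Prod>(K-{0})"
        by (simp add: prod.distrib)
      hence "x ^ card (K - {0}) = 1" by simp
      moreover have "card (K - {0}) = q - 1"
        using subfield card_K by (simp add: is_subfield_def)
      moreover have "x ^ q = x * x ^ (q - 1)"
        using q_ge_2 by (simp flip: power_Suc)
      ultimately show ?thesis by simp
    qed (use q_ge_2 in auto)
  qed
  have "{x::'a. x ^ q = x} = {x. x ^ q + 1 * x = 0}" by (auto simp: add_eq_0_iff_eq)
  hence "card {x::'a. x ^ q = x} \<le> card K"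
    using card_roots_trinomial_le[OF q_ge_2, of "1::'a" 0] card_K by simp
  hence "K = {x. x ^ q = x}"
    using card_seteq[OF _ sub] by simp
  thus ?thesis by blast
qed

lemma K_closed [intro, simp]:
  "0 \<in> K" "1 \<in> K" "x \<in> K \<Longrightarrow> y \<in> K \<Longrightarrow> x + y \<in> K"
  "x \<in> K \<Longrightarrow> y \<in> K \<Longrightarrow> x * y \<in> K" "x \<in> K \<Longrightarrow> y \<in> K \<Longrightarrow> x / y \<in> K" "x \<in> K \<Longrightarrow> x ^ n \<in> K"
  using q_ge_2
  by (auto simp: mem_K_iff frob_add power_mult_distrib power_divide)
     (metis power_mult mult.commute)

lemma norm_in_K: "x ^ (q + 1) \<in> K"
  by (simp add: mem_K_iff power_mult_distrib power_q_q mult.commute)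

lemma trace_in_K [simp]: "x ^ q + x \<in> K"
  by (simp add: mem_K_iff frob_add power_q_q add.commute)

lemma card_norm_eq:
  assumes "a \<in> K" "a \<noteq> 0"
  shows "card {x. x ^ (q + 1) = a} = q + 1"
proof -
  have "card {x\<in>UNIV - {0}. x ^ (q + 1) = a} = q + 1"
  proof (rule card_fibre_eq[where B = "K - {0}"])
    show "card {x \<in> UNIV - {0}. x ^ (q + 1) = y} \<le> q + 1" for y :: 'a
    proof -
      have "card {x \<in> UNIV - {0}. x ^ (q + 1) = y} \<le> card {x. x ^ (q + 1) + 0 * x = y}"
        by (intro card_mono) auto
      also have "\<dots> \<le> q + 1" using q_ge_2 by (intro card_roots_trinomial_le) auto
      finally show ?thesis .
    qed
    have "card (UNIV - {0::'a}) = q ^ 2 - 1" by (simp add: card_field)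
    also have "\<dots> = (q + 1) * (q - 1)" by (simp add: power2_eq_square algebra_simps)
    also have "q - 1 = card (K - {0})" using card_K by simp
    finally show "card (UNIV - {0::'a}) = (q + 1) * card (K - {0})" .
  qed (use assms norm_in_K in auto)
  moreover have "{x\<in>UNIV - {0}. x ^ (q + 1) = a} = {x. x ^ (q + 1) = a}"
    using assms by auto
  ultimately show ?thesis by simp
qed

lemma card_trace_eq:
  assumes "a \<in> K"
  shows "card {x. x ^ q + x = a} = q"
proof -
  have "card {x\<in>UNIV. x ^ q + x = a} = q"
  proof (rule card_fibre_eq[where B = K])
    show "card {x \<in> UNIV. x ^ q + x = y} \<le> q" for y :: 'a
      using card_roots_trinomial_le[OF q_ge_2, of 1 y] by simp
  qed (use assms in \<open>auto simp: power2_eq_square card_K card_field\<close>)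
  thus ?thesis by simp
qed

text \<open>
  The preimage of \<open>K\<close> under \<open>z \<mapsto> z^2 + z\<close> contains all \<open>z\<close> of trace 0 or 1. These are \<open>2 q\<close>
  elements, and the map is at most two-to-one, so it maps them onto \<open>K\<close>.
\<close>
lemma artin_schreier_root:
  assumes "a \<in> K"
  obtains z where "z ^ 2 + z = a"
proof -
  let ?Z = "{z::'a. z ^ q + z = 0} \<union> {z. z ^ q + z = 1}"
  have "card ?Z = 2 * card K"
    by (subst card_Un_disjoint) (auto simp: card_trace_eq card_K)
  hence "card {z\<in>?Z. z ^ 2 + z = a} = 2"
  proof (rule card_fibre_eq[rotated 4])
    show "(\<lambda>z. z ^ 2 + z) ` ?Z \<subseteq> K"
    proof safe
      fix z :: 'a assume z: "z ^ q + z = 0"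
      hence "z ^ q = z" by (simp add: add_eq_0_iff_eq)
      thus "z ^ 2 + z \<in> K" by (intro K_closed) (simp_all add: mem_K_iff)
    next
      fix z :: 'a assume z: "z ^ q + z = 1"
      hence "z ^ q = z + 1" by (metis add.commute add_self_left)
      thus "z ^ 2 + z \<in> K"
        by (simp add: mem_K_iff frob_add power_mult_distrib power2_eq_square algebra_simps)
    qed
    show "card {z \<in> ?Z. z ^ 2 + z = y} \<le> 2" for y :: 'a
    proof -
      have "card {z \<in> ?Z. z ^ 2 + z = y} \<le> card {z. z ^ 2 + 1 * z = y}"
        by (intro card_mono) auto
      also have "\<dots> \<le> 2" by (intro card_roots_trinomial_le) auto
      finally show ?thesis .
    qed
  qed (use assms in auto)
  hence "{z\<in>?Z. z ^ 2 + z = a} \<noteq> {}" by (metis card.empty zero_neq_numeral)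
  thus ?thesis using that by blast
qed

text \<open>
  For \<open>A = 0\<close> square roots exist because squaring is bijective on \<open>K\<close>; otherwise the substitution
  \<open>s = A z\<close> gives the equation of the preceding lemma.
\<close>
lemma quadratic_root:
  assumes "A \<in> K" "C \<in> K"
  obtains s where "s ^ 2 + A * s + C = 0"
proof (cases "A = 0")
  case True
  have "(C ^ (q div 2)) ^ 2 = C ^ q" using even_q by (simp flip: power_mult)
  thus ?thesis using assms True that[of "C ^ (q div 2)"] by (simp add: mem_K_iff)
next
  case False
  obtain z where z: "z ^ 2 + z = C / A ^ 2"
    using artin_schreier_root assms by (metis K_closed(5,6))
  have "(A * z) ^ 2 + A * (A * z) = A ^ 2 * (z ^ 2 + z)"
    by (simp add: algebra_simps power2_eq_square)
  also have "\<dots> = C" using False z by simp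
  finally show ?thesis using that[of "A * z"] by simp
qed

text \<open>
  Conjugation permutes the two roots \<open>s\<close>, \<open>s'\<close>, and \<open>C = s s'\<close>. If it exchanges distinct roots,
  both have norm \<open>C\<close> and neither is in \<open>K\<close>. If it fixes distinct roots, both are in \<open>K\<close> and their
  norms are their squares, which differ from \<open>s s'\<close> as \<open>C \<noteq> 0\<close>. A double root is counted once in
  each set.
\<close>
lemma quadratic_root_dichotomy:
  assumes A: "A \<in> K" and C: "C \<in> K" "C \<noteq> 0"
  shows "card {s\<in>K. s ^ 2 + A * s + C = 0} + card {s. s ^ 2 + A * s + C = 0 \<and> s ^ (q + 1) = C} = 2"
proof -
  obtain s where s: "s ^ 2 + A * s + C = 0" using quadratic_root[OF A C(1)] .
  define s' where "s' = s + A"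
  have "s * (s + A) + C = 0" using s by (simp add: algebra_simps power2_eq_square)
  hence C_eq: "C = s * s'" by (simp add: s'_def add_eq_0_iff_eq)
  have A_eq: "A = s + s'" by (simp add: s'_def)
  have "x ^ 2 + A * x + C = (x + s) * (x + s')" for x
    by (simp add: A_eq C_eq algebra_simps power2_eq_square)
  hence roots: "x ^ 2 + A * x + C = 0 \<longleftrightarrow> x = s \<or> x = s'" for x
    by (simp add: add_eq_0_iff_eq)
  have nz: "s \<noteq> 0" "s' \<noteq> 0" using C C_eq by auto
  have "(s ^ q) ^ 2 + A * s ^ q + C = (s ^ 2 + A * s + C) ^ q"
    using A C by (simp add: frob_add power_mult_distrib mem_K_iff power2_eq_square)
  hence "s ^ q = s \<or> s ^ q = s'"
    using s roots by simp
  \<comment> \<open>A double root, two roots in \<open>K\<close>, or two conjugate roots outside \<open>K\<close>.\<close>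
  then consider "s ^ q = s" "s' = s" | "s ^ q = s" "s' \<noteq> s" | "s ^ q = s'" "s' \<noteq> s"
    by metis
  thus ?thesis
  proof cases
    case 1
    have "{s\<in>K. s ^ 2 + A * s + C = 0} = {s}"
         "{s. s ^ 2 + A * s + C = 0 \<and> s ^ (q + 1) = C} = {s}"
      unfolding roots using 1 by (auto simp: C_eq mem_K_iff)
    thus ?thesis by simp
  next
    case 2
    have "s' ^ q = s'" using 2 A by (simp add: s'_def frob_add mem_K_iff)
    hence "{s\<in>K. s ^ 2 + A * s + C = 0} = {s, s'}"
          "{s. s ^ 2 + A * s + C = 0 \<and> s ^ (q + 1) = C} = {}"
      unfolding roots using 2 nz by (auto simp: C_eq mem_K_iff)
    thus ?thesis using 2 by simp
  next
    case 3
    have "s' ^ q = s" using 3(1) power_q_q by metis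
    hence "{s\<in>K. s ^ 2 + A * s + C = 0} = {}"
          "{s. s ^ 2 + A * s + C = 0 \<and> s ^ (q + 1) = C} = {s, s'}"
      unfolding roots using 3 by (auto simp: C_eq mem_K_iff mult.commute)
    thus ?thesis using 3 by simp
  qed
qed

section \<open>Zeros of f and norm-one roots of h\<close>

text \<open>
  So 1 is a root of \<open>h\<close> only if \<open>b^q = c\<close>. This is why the index \<open>i = 0\<close> (equivalently
  \<open>i = q + 1\<close>) can be left out of \<open>N\<close>.
\<close>
lemma h_fun_1: "h_fun q b c d (1::'a) = (b ^ q + c) ^ (q + 1)"
  by (simp add: h_fun_def Tr_def frob_add power_q_q power_mult_distrib algebra_simps)

text \<open>
  The sum \<open>f(x) + f(x)^q\<close> has no term of degree \<open>q + 1\<close> and equals \<open>s + s^q\<close>, so a zero of \<open>f\<close>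
  gives \<open>s\<close> in \<open>K\<close>. For such \<open>s\<close>, expressing \<open>e x\<close> and its conjugate through \<open>s\<close> turns
  \<open>e^(q+1) f(x)\<close> into a quadratic in \<open>s\<close>; the shift by \<open>b^(q+1)\<close> is chosen so that its constant
  term is a norm.
\<close>
lemma f_fun_zero_iff:
  fixes b c d x :: 'a
  assumes ne: "b ^ q \<noteq> c"
  defines "e \<equiv> b ^ q + c" and "A \<equiv> Tr q d + b ^ (q + 1) + c ^ (q + 1)"
  defines "s \<equiv> e * x + d + b ^ (q + 1)"
  shows "f_fun q b c d x = 0 \<longleftrightarrow> s \<in> K \<and> s ^ 2 + A * s + (d + b * c) ^ (q + 1) = 0"
proof -
  have e: "e \<noteq> 0" using ne by (simp add: e_def add_eq_0_iff_eq)
  have eq: "e ^ q = b + c ^ q" by (simp add: e_def frob_add power_q_q)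
  have sq: "s ^ q = e ^ q * x ^ q + d ^ q + b ^ (q + 1)"
    by (simp add: s_def frob_add power_mult_distrib power_q_q mult.commute)
  have "f_fun q b c d x + f_fun q b c d x ^ q = s + s ^ q"
    unfolding sq eq
    by (simp add: f_fun_def s_def e_def frob_add power_mult_distrib power_q_q algebra_simps)
  hence K: "s \<in> K" if "f_fun q b c d x = 0"
    using that q_ge_2 by (simp add: mem_K_iff add_eq_0_iff_eq)
  have eqn: "e ^ (q + 1) * f_fun q b c d x = s ^ 2 + A * s + (d + b * c) ^ (q + 1)" if "s \<in> K"
  proof -
    have "e ^ q * x ^ q = s ^ q + d ^ q + b ^ (q + 1)"
      unfolding sq by (simp add: algebra_simps)
    hence "e ^ q * x ^ q = s + d ^ q + b ^ (q + 1)"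
      using that by (simp add: mem_K_iff)
    moreover have "e * x = s + d + b ^ (q + 1)"
      by (simp add: s_def algebra_simps)
    moreover have "e ^ (q + 1) * f_fun q b c d x =
        (e * x) * (e ^ q * x ^ q) + b * e * (e ^ q * x ^ q) + c * e ^ q * (e * x) + d * e * e ^ q"
      by (simp add: f_fun_def algebra_simps)
    ultimately have "e ^ (q + 1) * f_fun q b c d x =
        (s + d + b ^ (q + 1)) * (s + d ^ q + b ^ (q + 1)) + b * e * (s + d ^ q + b ^ (q + 1))
        + c * e ^ q * (s + d + b ^ (q + 1)) + d * e * e ^ q"
      by simp
    also have "\<dots> = s ^ 2 + A * s + (d + b * c) ^ (q + 1)"
      unfolding eq
      by (simp add: e_def A_def Tr_def frob_add power_mult_distrib power2_eq_square algebra_simps)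
    finally show ?thesis .
  qed
  show ?thesis using K eqn e by auto
qed

lemma card_zeros_eq_quadratic:
  fixes b c d :: 'a
  assumes ne: "b ^ q \<noteq> c"
  shows "card {x. f_fun q b c d x = 0} =
    card {s\<in>K. s ^ 2 + (Tr q d + b ^ (q + 1) + c ^ (q + 1)) * s + (d + b * c) ^ (q + 1) = 0}"
proof -
  define e where "e = b ^ q + c"
  have e: "e \<noteq> 0" using ne by (simp add: e_def add_eq_0_iff_eq)
  have inv: "e * ((s + d + b ^ (q + 1)) / e) + d + b ^ (q + 1) = s" for s
    using e by (simp add: add_ac)
  have inv': "(e * x + d + b ^ (q + 1) + d + b ^ (q + 1)) / e = x" for x
    using e by (simp add: add_ac)
  have "bij_betw (\<lambda>x. e * x + d + b ^ (q + 1)) {x. f_fun q b c d x = 0}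
    {s\<in>K. s ^ 2 + (Tr q d + b ^ (q + 1) + c ^ (q + 1)) * s + (d + b * c) ^ (q + 1) = 0}"
  proof (rule bij_betw_byWitness[where f' = "\<lambda>s. (s + d + b ^ (q + 1)) / e"])
    show "(\<lambda>s. (s + d + b ^ (q + 1)) / e) ` {s\<in>K. s ^ 2 + (Tr q d + b ^ (q + 1) + c ^ (q + 1)) * s
        + (d + b * c) ^ (q + 1) = 0} \<subseteq> {x. f_fun q b c d x = 0}"
      unfolding f_fun_zero_iff[OF ne] e_def[symmetric] by (auto simp only: inv)
    show "(\<lambda>x. e * x + d + b ^ (q + 1)) ` {x. f_fun q b c d x = 0} \<subseteq> {s\<in>K. s ^ 2 +
        (Tr q d + b ^ (q + 1) + c ^ (q + 1)) * s + (d + b * c) ^ (q + 1) = 0}"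
      unfolding f_fun_zero_iff[OF ne] e_def[symmetric] by blast
  qed (use inv inv' in blast)+
  thus ?thesis by (rule bij_betw_same_card)
qed

lemma card_unit_roots_eq_quadratic:
  fixes b c d :: 'a
  assumes D: "d + b * c \<noteq> 0"
  shows "card {u. u ^ (q + 1) = 1 \<and> h_fun q b c d u = 0} =
    card {s. s ^ 2 + (Tr q d + b ^ (q + 1) + c ^ (q + 1)) * s + (d + b * c) ^ (q + 1) = 0
      \<and> s ^ (q + 1) = (d + b * c) ^ (q + 1)}"
proof -
  define D where "D = d + b * c"
  define A where "A = Tr q d + b ^ (q + 1) + c ^ (q + 1)"
  have nz: "D \<noteq> 0" using D by (simp add: D_def)
  have "h_fun q b c d u = D ^ q * u ^ 2 + A * u + D" for u
    by (simp add: h_fun_def D_def A_def add.assoc)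
  hence quad: "(D ^ q * u) ^ 2 + A * (D ^ q * u) + D ^ (q + 1) = D ^ q * h_fun q b c d u" for u
    by (simp add: algebra_simps power2_eq_square)
  have norm: "(D ^ q * u) ^ (q + 1) = D ^ (q + 1) * u ^ (q + 1)" for u
    by (simp add: power_mult_distrib power_q_q)
  have "bij_betw (\<lambda>u. D ^ q * u) {u. u ^ (q + 1) = 1 \<and> h_fun q b c d u = 0}
    {s. s ^ 2 + A * s + D ^ (q + 1) = 0 \<and> s ^ (q + 1) = D ^ (q + 1)}"
  proof (rule bij_betw_byWitness[where f' = "\<lambda>s. s / D ^ q"])
    show "(\<lambda>u. D ^ q * u) ` {u. u ^ (q + 1) = 1 \<and> h_fun q b c d u = 0} \<subseteq>
        {s. s ^ 2 + A * s + D ^ (q + 1) = 0 \<and> s ^ (q + 1) = D ^ (q + 1)}"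
      by (auto simp only: quad norm mult_zero_right mult_1_right)
    show "(\<lambda>s. s / D ^ q) ` {s. s ^ 2 + A * s + D ^ (q + 1) = 0 \<and> s ^ (q + 1) = D ^ (q + 1)} \<subseteq>
        {u. u ^ (q + 1) = 1 \<and> h_fun q b c d u = 0}"
    proof safe
      fix s assume s: "s ^ 2 + A * s + D ^ (q + 1) = 0" "s ^ (q + 1) = D ^ (q + 1)"
      have "D ^ q * (s / D ^ q) = s" using nz by simp
      thus "(s / D ^ q) ^ (q + 1) = 1" "h_fun q b c d (s / D ^ q) = 0"
        using s nz quad[of "s / D ^ q"] norm[of "s / D ^ q"] by (auto simp del: power_Suc)
    qed
  qed (use nz in auto)
  thus ?thesis unfolding A_def D_def by (rule bij_betw_same_card)
qed

text \<open>
  For \<open>d + b c = 0\<close> the rescaling by \<open>(d + b c)^q\<close> is not available, but then \<open>h(u) = A u\<close>, where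
  \<open>A = h(1)\<close> is nonzero: the only root 0 does not have norm 1, while the quadratic has the two
  roots 0 and \<open>A\<close> in \<open>K\<close>.
\<close>
lemma card_zeros_plus_card_unit_roots:
  fixes b c d :: 'a
  assumes ne: "b ^ q \<noteq> c"
  shows "card {x. f_fun q b c d x = 0} + card {u. u ^ (q + 1) = 1 \<and> h_fun q b c d u = 0} = 2"
proof -
  define A where "A = Tr q d + b ^ (q + 1) + c ^ (q + 1)"
  have A: "A \<in> K" unfolding A_def Tr_def by (intro K_closed norm_in_K trace_in_K)
  show ?thesis
  proof (cases "d + b * c = 0")
    case False
    have "(d + b * c) ^ (q + 1) \<noteq> 0" using False by simp
    from quadratic_root_dichotomy[OF A norm_in_K this] show ?thesis
      unfolding card_zeros_eq_quadratic[OF ne] card_unit_roots_eq_quadratic[OF False]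
      by (simp only: A_def)
  next
    case True
    have hA: "h_fun q b c d u = A * u" for u
      using True q_ge_2 by (simp add: h_fun_def A_def add.assoc)
    have "(b ^ q + c) ^ (q + 1) \<noteq> 0" using ne by (simp add: add_eq_0_iff_eq)
    hence "A \<noteq> 0" by (metis h_fun_1 hA mult_1_right)
    hence "{u. u ^ (q + 1) = 1 \<and> h_fun q b c d u = 0} = {}"
      by (auto simp: hA)
    moreover have "{s\<in>K. s ^ 2 + A * s + (d + b * c) ^ (q + 1) = 0} = {0, A}"
    proof -
      have "s ^ 2 + A * s + (d + b * c) ^ (q + 1) = s * (s + A)" for s
        using True by (simp add: power2_eq_square algebra_simps)
      thus ?thesis using A by (auto simp: add_eq_0_iff_eq simp del: power_Suc)
    qed
    ultimately show ?thesis
      using \<open>A \<noteq> 0\<close> unfolding card_zeros_eq_quadratic[OF ne] by (simp add: A_def)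
  qed
qed

lemma f_fun_shifted_norm:
  fixes b d x :: 'a
  shows "f_fun q b (b ^ q) d x = (x + b) ^ (q + 1) + (d + b ^ (q + 1))"
  by (simp add: f_fun_def frob_add algebra_simps)

lemma card_zeros_shifted_norm:
  fixes b d :: 'a
  shows "card {x. f_fun q b (b ^ q) d x = 0} =
    (if d \<notin> K then 0 else if d = b ^ (q + 1) then 1 else q + 1)"
proof -
  have "bij_betw (\<lambda>x. x + b) {x. f_fun q b (b ^ q) d x = 0} {y. y ^ (q + 1) = d + b ^ (q + 1)}"
    by (rule bij_betw_byWitness[where f' = "\<lambda>y. y + b"])
       (auto simp: f_fun_shifted_norm add_eq_0_iff_eq add.assoc simp del: power_Suc)
  hence *: "card {x. f_fun q b (b ^ q) d x = 0} = card {y. y ^ (q + 1) = d + b ^ (q + 1)}"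
    by (rule bij_betw_same_card)
  consider "d \<notin> K" | "d = b ^ (q + 1)" "d \<in> K" | "d \<in> K" "d \<noteq> b ^ (q + 1)" by blast
  thus ?thesis
  proof cases
    case 1
    have "y ^ (q + 1) \<noteq> d + b ^ (q + 1)" for y
    proof
      assume "y ^ (q + 1) = d + b ^ (q + 1)"
      hence "d = y ^ (q + 1) + b ^ (q + 1)" by (simp add: add.assoc)
      thus False using 1 K_closed(3)[OF norm_in_K norm_in_K] by metis
    qed
    thus ?thesis using * 1 by simp
  next
    case 2
    have "{y::'a. y ^ (q + 1) = d + b ^ (q + 1)} = {0}" using 2 by auto
    thus ?thesis using * 2 by simp
  next
    case 3
    have "d + b ^ (q + 1) \<in> K" "d + b ^ (q + 1) \<noteq> 0"
      using 3 by (auto simp only: add_eq_0_iff_eq intro!: K_closed(3) norm_in_K)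
    from card_norm_eq[OF this] show ?thesis using * 3 by simp
  qed
qed

section \<open>Parametrising the elements of norm 1\<close>

text \<open>
  If \<open>\<alpha>^n = 1\<close>, exponents matter only modulo \<open>n\<close>, so the powers of \<open>\<alpha>\<close> are too few to exhaust
  the nonzero elements unless \<open>n \<ge> q^2 - 1\<close>.
\<close>
lemma primitive_element_order:
  fixes \<alpha> :: 'a
  assumes "primitive_element \<alpha>" "\<alpha> ^ n = 1" "n > 0"
  shows "q ^ 2 - 1 \<le> n"
proof -
  have "UNIV - {0} \<subseteq> (\<lambda>i. \<alpha> powi i) ` {0..<int n}"
  proof
    fix x :: 'a assume "x \<in> UNIV - {0}"
    then obtain i where i: "x = \<alpha> powi i"
      using assms(1) unfolding primitive_element_def by blast
    have "\<alpha> \<noteq> 0" by (rule primitive_element_nonzero[OF assms(1)])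
    hence "\<alpha> powi i = \<alpha> powi (int n * (i div int n)) * \<alpha> powi (i mod int n)"
      by (simp flip: power_int_add)
    also have "\<dots> = \<alpha> powi (i mod int n)"
      using assms by (simp add: power_int_mult)
    finally show "x \<in> (\<lambda>i. \<alpha> powi i) ` {0..<int n}"
      using i assms by auto
  qed
  hence "card (UNIV - {0::'a}) \<le> card {0..<int n}"
    by (meson surj_card_le finite_atLeastLessThan_int)
  thus ?thesis by (simp add: card_field)
qed

text \<open>
  For \<open>0 \<le> i \<le> q\<close> the exponents \<open>i (q - 1)\<close> differ by less than \<open>q^2 - 1\<close>, so these powers are
  \<open>q + 1\<close> distinct elements of norm 1, and there are no others. The index 0 accounts for the
  element 1.
\<close>
lemma bij_betw_norm_1:
  fixes \<alpha> :: 'a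
  assumes prim: "primitive_element \<alpha>"
  shows "bij_betw (\<lambda>i. \<alpha> powi (i * (int q - 1))) {1..int q} ({u. u ^ (q + 1) = 1} - {1})"
proof -
  let ?g = "\<lambda>i. \<alpha> powi (i * (int q - 1))"
  have nz: "\<alpha> \<noteq> 0" by (rule primitive_element_nonzero[OF prim])
  have not_less: False if ij: "?g i = ?g j" "0 \<le> i" "i < j" "j \<le> int q" for i j
  proof -
    define n where "n = nat ((j - i) * (int q - 1))"
    have n: "int n = (j - i) * (int q - 1)" "n > 0"
      using ij q_ge_2 by (auto simp: n_def)
    have "\<alpha> powi (int n) = ?g j / ?g i"
      unfolding n by (simp add: left_diff_distrib power_int_diff nz)
    hence "\<alpha> ^ n = 1" using ij nz by simp
    hence "int (q ^ 2 - 1) \<le> int n"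
      using primitive_element_order[OF prim] n(2) by simp
    moreover have "int n \<le> int q * (int q - 1)"
      unfolding n(1) using ij q_ge_2 by (intro mult_right_mono) auto
    moreover have "int (q ^ 2 - 1) = int q * int q - 1"
      using q_ge_2 by (simp add: of_nat_diff power2_eq_square)
    moreover have "int q * (int q - 1) = int q * int q - int q"
      by (simp add: right_diff_distrib)
    ultimately show False using q_ge_2 by linarith
  qed
  have inj: "inj_on ?g {0..int q}"
    by (rule linorder_inj_onI) (use not_less in auto)
  have "?g i ^ (q + 1) = 1" for i
  proof -
    have "?g i ^ (q + 1) = \<alpha> powi (int (q ^ 2 - 1) * i)"
      using q_ge_2
      by (simp only: power_int_power') (simp add: of_nat_diff power2_eq_square algebra_simps)
    also have "\<dots> = (\<alpha> ^ (q ^ 2 - 1)) powi i" by (simp only: power_int_power)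
    also have "\<alpha> ^ (q ^ 2 - 1) = 1"
    proof -
      have "\<alpha> * \<alpha> ^ (q ^ 2 - 1) = \<alpha> ^ (q ^ 2)"
        using q_ge_2 by (simp flip: power_Suc)
      also have "\<dots> = \<alpha>" using power_q_q[of \<alpha>] by (simp add: power2_eq_square power_mult)
      finally show ?thesis using nz by simp
    qed
    finally show ?thesis by simp
  qed
  hence "?g ` {0..int q} \<subseteq> {u. u ^ (q + 1) = 1}" by auto
  moreover have "card (?g ` {0..int q}) = card {u::'a. u ^ (q + 1) = 1}"
    by (subst card_image[OF inj], subst card_norm_eq) auto
  ultimately have "?g ` {0..int q} = {u. u ^ (q + 1) = 1}"
    by (intro card_subset_eq) auto
  hence "bij_betw ?g {0..int q} {u. u ^ (q + 1) = 1}" using inj by (simp add: bij_betw_def)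
  from bij_betw_DiffI[OF this, of "{0}" "{1}"]
  have "bij_betw ?g ({0..int q} - {0}) ({u. u ^ (q + 1) = 1} - {1})"
    by (auto simp: bij_betw_def)
  moreover have "{0..int q} - {0} = {1..int q}" by auto
  ultimately show ?thesis by simp
qed

lemma card_zeros_eq_2_minus_card_N:
  fixes b c d \<alpha> :: 'a
  assumes prim: "primitive_element \<alpha>" and ne: "b ^ q \<noteq> c"
  shows "int (card {x. f_fun q b c d x = 0}) = 2 - int (card (N_set q \<alpha> b c d))"
proof -
  let ?g = "\<lambda>i. \<alpha> powi (i * (int q - 1))"
  have h1: "h_fun q b c d 1 \<noteq> 0"
    using ne h_fun_1[of b c d] by (simp add: add_eq_0_iff_eq)
  have bij: "bij_betw ?g {1..int q} ({u. u ^ (q + 1) = 1} - {1})"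
    by (rule bij_betw_norm_1[OF prim])
  have "u \<in> ?g ` N_set q \<alpha> b c d \<longleftrightarrow> u ^ (q + 1) = 1 \<and> h_fun q b c d u = 0" for u
  proof -
    have "u \<in> ?g ` N_set q \<alpha> b c d \<longleftrightarrow> u \<in> ?g ` {1..int q} \<and> h_fun q b c d u = 0"
      unfolding N_set_def atLeastAtMost_iff image_iff Bex_def mem_Collect_eq by metis
    also have "\<dots> \<longleftrightarrow> u \<in> {u. u ^ (q + 1) = 1} - {1} \<and> h_fun q b c d u = 0"
      unfolding bij_betw_imp_surj_on[OF bij] ..
    finally show ?thesis using h1 by blast
  qed
  hence "?g ` N_set q \<alpha> b c d = {u. u ^ (q + 1) = 1 \<and> h_fun q b c d u = 0}" by blast
  moreover have "N_set q \<alpha> b c d \<subseteq> {1..int q}" by (auto simp: N_set_def)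
  ultimately have "bij_betw ?g (N_set q \<alpha> b c d) {u. u ^ (q + 1) = 1 \<and> h_fun q b c d u = 0}"
    using bij_betw_subset[OF bij] by blast
  hence "card (N_set q \<alpha> b c d) = card {u. u ^ (q + 1) = 1 \<and> h_fun q b c d u = 0}"
    by (rule bij_betw_same_card)
  thus ?thesis using card_zeros_plus_card_unit_roots[OF ne, of d] by simp
qed

text \<open>
  Clearing denominators, \<open>b^(2q) h(c / b^q) = (b^q + c) (b^q d + c d^q)\<close> once the two norms agree.
\<close>
lemma h_fun_special_point:
  fixes b c d :: 'a
  assumes ne: "b ^ q \<noteq> c" and nm: "b ^ (q + 1) = c ^ (q + 1)" and b: "b \<noteq> 0"
  shows "h_fun q b c d (c / b ^ q) = 0 \<longleftrightarrow> b ^ q * d + c * d ^ q = 0"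
proof -
  have nm0: "b ^ (q + 1) + c ^ (q + 1) = 0"
    unfolding nm by (rule add_self)
  have "(b ^ q) ^ 2 * h_fun q b c d u =
      (d + b * c) ^ q * (b ^ q * u) ^ 2
      + (Tr q d + b ^ (q + 1) + c ^ (q + 1)) * (b ^ q * u * b ^ q)
      + (d + b * c) * (b ^ q) ^ 2" for u
    by (simp add: h_fun_def algebra_simps power2_eq_square)
  from this[of "c / b ^ q"]
  have "(b ^ q) ^ 2 * h_fun q b c d (c / b ^ q) =
      (d + b * c) ^ q * c ^ 2 + (Tr q d + b ^ (q + 1) + c ^ (q + 1)) * (c * b ^ q)
      + (d + b * c) * (b ^ q) ^ 2"
    using b by simp
  also have "\<dots> = (d + b * c) ^ q * c ^ 2 + Tr q d * (c * b ^ q) + (d + b * c) * (b ^ q) ^ 2"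
    by (simp only: add.assoc nm0 add_0_right)
  also have "\<dots> = (b ^ q + c) * (b ^ q * d + c * d ^ q)
      + c * b ^ q * (b ^ (q + 1) + c ^ (q + 1))"
    by (simp add: Tr_def frob_add power_mult_distrib power2_eq_square algebra_simps)
  also note nm0
  finally have "(b ^ q) ^ 2 * h_fun q b c d (c / b ^ q) = (b ^ q + c) * (b ^ q * d + c * d ^ q)"
    by simp
  moreover have "b ^ q + c \<noteq> 0" "(b ^ q) ^ 2 \<noteq> 0"
    using ne b by (simp_all add: add_eq_0_iff_eq)
  ultimately show ?thesis by (metis mult_eq_0_iff)
qed

lemma admissible_k_iff:
  fixes b c \<alpha> :: 'a
  assumes nz: "\<alpha> \<noteq> 0" and b: "b \<noteq> 0"
  shows "admissible_k q \<alpha> b c k \<longleftrightarrow>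
    1 \<le> k \<and> k \<le> int q \<and> \<alpha> powi (k * (int q - 1)) = c / b ^ q"
proof -
  have "k * int q = k * (int q - 1) + k" by (simp add: algebra_simps)
  hence "\<alpha> powi (k * int q) = \<alpha> powi (k * (int q - 1)) * \<alpha> powi k"
    by (metis nz power_int_add)
  hence "b ^ q * \<alpha> powi (k * int q) + c * \<alpha> powi k
      = (b ^ q * \<alpha> powi (k * (int q - 1)) + c) * \<alpha> powi k"
    by (simp add: algebra_simps)
  hence "b ^ q * \<alpha> powi (k * int q) + c * \<alpha> powi k = 0 \<longleftrightarrow>
      b ^ q * \<alpha> powi (k * (int q - 1)) = c"
    using nz by (simp add: add_eq_0_iff_eq)
  thus ?thesis using b by (auto simp: admissible_k_def field_simps)
qed

lemma zeros_in_special_case: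
  fixes b c d \<alpha> :: 'a
  assumes prim: "primitive_element \<alpha>"
    and ne: "b ^ q \<noteq> c" and nm: "b ^ (q + 1) = c ^ (q + 1)"
  shows "\<exists>k. admissible_k q \<alpha> b c k"
    and "admissible_k q \<alpha> b c k \<Longrightarrow> int (card {x. f_fun q b c d x = 0}) =
      (if b ^ q * d + c * d ^ q = 0 then 1 else 2) - int (card (N'_set q \<alpha> b c d k))"
proof -
  have b: "b \<noteq> 0" using ne nm q_ge_2 by auto
  have nz: "\<alpha> \<noteq> 0" by (rule primitive_element_nonzero[OF prim])
  note adm = admissible_k_iff[OF nz b]
  have "(c / b ^ q) ^ (q + 1) = c ^ (q + 1) / b ^ (q + 1)"
    by (simp add: power_divide power_mult_distrib power_q_q mult.commute)
  also have "\<dots> = 1" unfolding nm[symmetric] using b by simp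
  finally have "c / b ^ q \<in> {u. u ^ (q + 1) = 1} - {1}"
    using ne b by (simp add: divide_eq_1_iff del: power_Suc)
  hence "c / b ^ q \<in> (\<lambda>i. \<alpha> powi (i * (int q - 1))) ` {1..int q}"
    unfolding bij_betw_imp_surj_on[OF bij_betw_norm_1[OF prim]] .
  then obtain j where "c / b ^ q = \<alpha> powi (j * (int q - 1))" "j \<in> {1..int q}"
    by (rule imageE)
  hence "admissible_k q \<alpha> b c j" by (simp add: adm)
  thus "\<exists>k. admissible_k q \<alpha> b c k" ..
  assume k: "admissible_k q \<alpha> b c k"
  have fin: "finite (N_set q \<alpha> b c d)"
    by (rule finite_subset[of _ "{1..int q}"]) (auto simp: N_set_def)
  have N': "N'_set q \<alpha> b c d k = N_set q \<alpha> b c d - {k}"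
    by (auto simp: N_set_def N'_set_def)
  have "k \<in> N_set q \<alpha> b c d \<longleftrightarrow> b ^ q * d + c * d ^ q = 0"
    using k h_fun_special_point[OF ne nm b] by (simp add: N_set_def adm)
  thus "int (card {x. f_fun q b c d x = 0}) =
      (if b ^ q * d + c * d ^ q = 0 then 1 else 2) - int (card (N'_set q \<alpha> b c d k))"
    using card_Suc_Diff1[OF fin, of k] card_zeros_eq_2_minus_card_N[OF prim ne, of d]
    unfolding N' by auto
qed

end

section \<open>The number of zeros\<close>

theorem lemma3p4:
  fixes q :: nat and K :: "'a::finite_field set" and \<alpha> b c d :: 'a
  assumes q: "\<exists>m::nat. m \<ge> 1 \<and> q = 2 ^ m"
    and card_field: "CARD('a) = q ^ 2"
    and subfield: "is_subfield K" and card_subfield: "card K = q"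
    and prim: "primitive_element \<alpha>"
  shows "let M = int (card {x. f_fun q b c d x = 0}) in
      (b = 0 \<and> c = 0 \<and> d = 0 \<longrightarrow> M = 1) \<and>
      (b = 0 \<and> c = 0 \<and> d \<in> K - {0} \<longrightarrow> M = int q + 1) \<and>
      (b = 0 \<and> c = 0 \<and> d \<notin> K \<longrightarrow> M = 0) \<and>
      (b ^ q = c \<and> c \<noteq> 0 \<and> d \<in> K \<and> d = c ^ (q + 1) \<longrightarrow> M = 1) \<and>
      (b ^ q = c \<and> c \<noteq> 0 \<and> d \<in> K \<and> d \<noteq> c ^ (q + 1) \<longrightarrow> M = int q + 1) \<and>
      (b ^ q = c \<and> c \<noteq> 0 \<and> d \<notin> K \<longrightarrow> M = 0) \<and>
      (b ^ q \<noteq> c \<and> b ^ (q + 1) = c ^ (q + 1) \<longrightarrow>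
         (\<exists>k. admissible_k q \<alpha> b c k) \<and>
         (\<forall>k. admissible_k q \<alpha> b c k \<longrightarrow>
            (b ^ q * d + c * d ^ q = 0 \<longrightarrow> M = 1 - int (card (N'_set q \<alpha> b c d k))) \<and>
            (b ^ q * d + c * d ^ q \<noteq> 0 \<longrightarrow> M = 2 - int (card (N'_set q \<alpha> b c d k))))) \<and>
      (b ^ (q + 1) \<noteq> c ^ (q + 1) \<longrightarrow> M = 2 - int (card (N_set q \<alpha> b c d)))"
proof -
  interpret char2_quadratic_extension q K
    using assms by unfold_locales auto
  have norm_conj: "(b ^ q) ^ (q + 1) = b ^ (q + 1)"
    by (simp add: power_q_q mult.commute)
  have zeros: "card {x. f_fun q b c d x = 0} =
      (if d \<notin> K then 0 else if d = c ^ (q + 1) then 1 else q + 1)" if "b ^ q = c"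
    unfolding that[symmetric] norm_conj by (rule card_zeros_shifted_norm)
  show ?thesis
    unfolding Let_def
  proof (intro conjI impI)
    assume "b = 0 \<and> c = 0 \<and> d = 0"
    thus "int (card {x. f_fun q b c d x = 0}) = 1" using zeros by simp
  next
    assume "b = 0 \<and> c = 0 \<and> d \<in> K - {0}"
    thus "int (card {x. f_fun q b c d x = 0}) = int q + 1" using zeros by simp
  next
    assume "b = 0 \<and> c = 0 \<and> d \<notin> K"
    thus "int (card {x. f_fun q b c d x = 0}) = 0" using zeros by simp
  next
    assume "b ^ q = c \<and> c \<noteq> 0 \<and> d \<in> K \<and> d = c ^ (q + 1)"
    thus "int (card {x. f_fun q b c d x = 0}) = 1" using zeros norm_in_K[of c] by simp
  next
    assume "b ^ q = c \<and> c \<noteq> 0 \<and> d \<in> K \<and> d \<noteq> c ^ (q + 1)"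
    thus "int (card {x. f_fun q b c d x = 0}) = int q + 1" using zeros by simp
  next
    assume "b ^ q = c \<and> c \<noteq> 0 \<and> d \<notin> K"
    thus "int (card {x. f_fun q b c d x = 0}) = 0" using zeros by simp
  next
    assume "b ^ q \<noteq> c \<and> b ^ (q + 1) = c ^ (q + 1)"
    thus "\<exists>k. admissible_k q \<alpha> b c k" using zeros_in_special_case(1)[OF prim] by blast
  next
    assume *: "b ^ q \<noteq> c \<and> b ^ (q + 1) = c ^ (q + 1)"
    show "\<forall>k. admissible_k q \<alpha> b c k \<longrightarrow>
        (b ^ q * d + c * d ^ q = 0 \<longrightarrow>
          int (card {x. f_fun q b c d x = 0}) = 1 - int (card (N'_set q \<alpha> b c d k))) \<and>
        (b ^ q * d + c * d ^ q \<noteq> 0 \<longrightarrow>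
          int (card {x. f_fun q b c d x = 0}) = 2 - int (card (N'_set q \<alpha> b c d k)))"
      using zeros_in_special_case(2)[OF prim, of b c _ d] * by simp
  next
    assume "b ^ (q + 1) \<noteq> c ^ (q + 1)"
    hence "b ^ q \<noteq> c" using norm_conj by (auto simp only:)
    thus "int (card {x. f_fun q b c d x = 0}) = 2 - int (card (N_set q \<alpha> b c d))"
      by (rule card_zeros_eq_2_minus_card_N[OF prim])
  qed
qed

end
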